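(* Let $p\in\{0\}\cup[1,\infty)$ and $N\ge2$. There is an $\mathcal{AW}_p$-Cauchy sequence $(\mu_n)_{n\ge1}$ in $\mathcal{P}_p(\mathbb{R}^N)$ which contains no $\mathcal{KR}_p$-Cauchy (sub)sequence; indeed $\inf\{\mathcal{KR}_p(\mu_k,\mu_n):k\ne n\}>0$.
   Context: $\lambda$ is Lebesgue measure on $(0,1)$ and $\lambda^N$ the product measure on $(0,1)^N$. For $p\in[1,\infty)$, $|x|_p^p:=\sum_i|x_i|^p$ and $\mathcal{P}_p(\mathbb{R}^N)$ is the set of Borel probability measures on $\mathbb{R}^N$ with finite $p$-th moment; $\mathcal{P}_0(\mathbb{R}^N)$ is the set of all Borel probability measures on $\mathbb{R}^N$. A (measurable) map $Q=(Q_k)_{k=1}^N:(0,1)^N\to\mathbb{R}^N$ is triangular if each $Q_k$ depends only on the first $k$ variables, and a triangular $Q$ is a quantile process if for all $k\le m\le N$ and $u_1,\dots,u_m,u_k'\in(0,1)$ with $u_k\le u_k'$: (inc) $Q_k(u_1,\dots,u_k)\le Q_k(u_1,\dots,u_{k-1},u_k')$; (con) if $Q_k(u_1,\dots,u_k)=Q_k(u_1,\dots,u_{k-1},u_k')$ then $Q_m(u_1,\dots,u_k,\dots,u_m)=Q_m(u_1,\dots,u_k',\dots,u_m)$. For every $\mu\in\mathcal{P}_0(\mathbb{R}^N)$ there is a $\lambda^N$-a.s. unique quantile process $Q^\mu$ with $Q^\mu_\#\lambda^N=\mu$. Explicitly, writing $\mu(dx)=\mu_1(dx_1)\mu_2^{x_1}(dx_2)\cdots\mu_N^{x_1,\dots,x_{N-1}}(dx_N)$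 for the successive disintegration, $Q^\mu_k(u_1,\dots,u_k)$ is the value at $u_k$ of the quantile function of $\mu_k^{Q^\mu_1(u_1),\dots,Q^\mu_{k-1}(u_1,\dots,u_{k-1})}$. $\mathcal{KR}_p(\mu,\nu):=\big(\int|Q^\mu-Q^\nu|_p^p\,d\lambda^N\big)^{1/p}$ for $p\ge1$ and $\mathcal{KR}_0(\mu,\nu):=\int(|Q^\mu-Q^\nu|\wedge1)\,d\lambda^N$. A coupling $\pi$ of $\mu$ and $\nu$ is bicausal, $\pi\in\Pi_{\rm bc}(\mu,\nu)$, if its successive disintegration $\pi=\pi_1(dx_1,dy_1)\,\pi_2^{x_1,y_1}(dx_2,dy_2)\cdots$ satisfies, $\pi$-a.s. and for all $k\le N$, that $\pi_k^{x_1,\dots,x_{k-1},y_1,\dots,y_{k-1}}$ is a coupling of $\mu_k^{x_1,\dots,x_{k-1}}$ and $\nu_k^{y_1,\dots,y_{k-1}}$. $\mathcal{AW}_p(\mu,\nu):=\inf_{\pi\in\Pi_{\rm bc}(\mu,\nu)}\big(\int|x-y|_p^p\,d\pi\big)^{1/p}$ for $p\ge1$ and $\mathcal{AW}_0(\mu,\nu):=\inf_{\pi\in\Pi_{\rm bc}(\mu,\nu)}\int(|x-y|\wedge1)\,d\pi$. *)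

theory Defs
  imports "HOL-Probability.Probability"
begin

text \<open>
  Points of \<open>'a\<^sup>N\<close> are functions \<open>nat \<Rightarrow> 'a\<close>, extensional on \<open>{..<N}\<close>; coordinates are numbered
  from \<open>0\<close>. The coordinate type is \<open>real\<close> for the marginals and \<open>real \<times> real\<close> for couplings.
\<close>

definition path_space :: "nat \<Rightarrow> (nat \<Rightarrow> 'a::topological_space) measure" where
  "path_space N = PiM {..<N} (\<lambda>_. borel)"

definition cube_measure :: "nat \<Rightarrow> (nat \<Rightarrow> real) measure" where
  "cube_measure N = PiM {..<N} (\<lambda>_. restrict_space lborel {0<..<1})"

definition prob_measures :: "real \<Rightarrow> nat \<Rightarrow> (nat \<Rightarrow> real) measure set" where
  "prob_measures p N = {\<mu> \<in> space (prob_algebra (path_space N)).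
     p \<noteq> 0 \<longrightarrow> integrable \<mu> (\<lambda>x. \<Sum>i<N. \<bar>x i\<bar> powr p)}"

text \<open>
  The integrands: \<open>|x - y| \<and> 1\<close> with the Euclidean norm for \<open>p = 0\<close>, and \<open>|x - y|\<^sub>p\<^sup>p\<close> for \<open>p \<ge> 1\<close>.
\<close>

definition path_cost :: "real \<Rightarrow> nat \<Rightarrow> (nat \<Rightarrow> real) \<Rightarrow> (nat \<Rightarrow> real) \<Rightarrow> real" where
  "path_cost p N x y =
     (if p = 0 then min (L2_set (\<lambda>i. x i - y i) {..<N}) 1
      else \<Sum>i<N. \<bar>x i - y i\<bar> powr p)"

definition cost_root :: "real \<Rightarrow> real \<Rightarrow> real" where
  "cost_root p c = (if p = 0 then c else c powr (1 / p))"


section \<open>Quantile processes and the Knothe--Rosenblatt distance\<close>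

definition triangular :: "nat \<Rightarrow> ((nat \<Rightarrow> real) \<Rightarrow> nat \<Rightarrow> real) \<Rightarrow> bool" where
  "triangular N Q \<longleftrightarrow> (\<forall>k<N. \<forall>u\<in>space (cube_measure N). \<forall>v\<in>space (cube_measure N).
     (\<forall>i\<le>k. u i = v i) \<longrightarrow> Q u k = Q v k)"

text \<open>
  The two implications below are (inc) and (con). By triangularity the coordinates of \<open>u\<close> beyond
  the \<open>m\<close>-th are immaterial for \<open>Q u m\<close>, so \<open>u\<close> may range over the whole cube.
\<close>

definition quantile_process :: "nat \<Rightarrow> ((nat \<Rightarrow> real) \<Rightarrow> nat \<Rightarrow> real) \<Rightarrow> bool" where
  "quantile_process N Q \<longleftrightarrow>
     Q \<in> cube_measure N \<rightarrow>\<^sub>M path_space N \<and>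
     triangular N Q \<and>
     (\<forall>u\<in>space (cube_measure N). \<forall>k<N. \<forall>v\<in>{0<..<1}. u k \<le> v \<longrightarrow>
        Q u k \<le> Q (u(k := v)) k \<and>
        (Q u k = Q (u(k := v)) k \<longrightarrow> (\<forall>m. k \<le> m \<and> m < N \<longrightarrow> Q u m = Q (u(k := v)) m)))"

text \<open>
  The quantile process with law \<open>\<mu>\<close> is unique up to null sets; a version is chosen.
\<close>

definition quantile_of :: "nat \<Rightarrow> (nat \<Rightarrow> real) measure \<Rightarrow> (nat \<Rightarrow> real) \<Rightarrow> nat \<Rightarrow> real" where
  "quantile_of N \<mu> = (SOME Q. quantile_process N Q \<and> distr (cube_measure N) (path_space N) Q = \<mu>)"

text \<open>
  \<open>KR\<close> and \<open>AW\<close> are meant for arguments in \<open>prob_measures p N\<close>, where all integrals are finite.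
\<close>

definition KR :: "real \<Rightarrow> nat \<Rightarrow> (nat \<Rightarrow> real) measure \<Rightarrow> (nat \<Rightarrow> real) measure \<Rightarrow> real" where
  "KR p N \<mu> \<nu> =
     cost_root p (\<integral>u. path_cost p N (quantile_of N \<mu> u) (quantile_of N \<nu> u) \<partial>cube_measure N)"


section \<open>Bicausal couplings and the adapted Wasserstein distance\<close>

text \<open>
  \<open>\<kappa> k x\<close>, with \<open>x\<close> a path of length \<open>k\<close>, is the conditional law of coordinate \<open>k\<close> given that the
  preceding coordinates are \<open>x\<close>. The equation says that the law of the first \<open>k + 1\<close> coordinates is
  the law of the first \<open>k\<close> coordinates followed by \<open>\<kappa> k\<close>.
\<close>

definition disintegration ::
    "nat \<Rightarrow> (nat \<Rightarrow> 'a::topological_space) measure \<Rightarrow> (nat \<Rightarrow> (nat \<Rightarrow> 'a) \<Rightarrow> 'a measure) \<Rightarrow> bool" where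
  "disintegration N \<mu> \<kappa> \<longleftrightarrow> (\<forall>k<N.
     \<kappa> k \<in> path_space k \<rightarrow>\<^sub>M prob_algebra borel \<and>
     distr \<mu> (path_space (Suc k)) (\<lambda>x. restrict x {..<Suc k}) =
       distr \<mu> (path_space k) (\<lambda>x. restrict x {..<k}) \<bind>
         (\<lambda>x. \<kappa> k x \<bind> (\<lambda>y. return (path_space (Suc k)) (x(k := y)))))"

definition zip_paths :: "nat \<Rightarrow> (nat \<Rightarrow> 'a) \<times> (nat \<Rightarrow> 'b) \<Rightarrow> nat \<Rightarrow> 'a \<times> 'b" where
  "zip_paths k z = (\<lambda>i\<in>{..<k}. (fst z i, snd z i))"

definition couplings ::
    "'a measure \<Rightarrow> 'b measure \<Rightarrow> ('a \<times> 'b) measure set" where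
  "couplings \<mu> \<nu> = {\<pi> \<in> space (prob_algebra (\<mu> \<Otimes>\<^sub>M \<nu>)). distr \<pi> \<mu> fst = \<mu> \<and> distr \<pi> \<nu> snd = \<nu>}"

text \<open>
  Disintegrations are unique up to null sets, so it does not matter which ones are taken.
\<close>

definition bicausal ::
    "nat \<Rightarrow> (nat \<Rightarrow> real) measure \<Rightarrow> (nat \<Rightarrow> real) measure \<Rightarrow>
       ((nat \<Rightarrow> real) \<times> (nat \<Rightarrow> real)) measure set" where
  "bicausal N \<mu> \<nu> = {\<pi> \<in> couplings \<mu> \<nu>. \<exists>\<kappa> \<kappa>' K.
     disintegration N \<mu> \<kappa> \<and> disintegration N \<nu> \<kappa>' \<and>
     disintegration N (distr \<pi> (path_space N) (zip_paths N)) K \<and>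
     (AE z in \<pi>. \<forall>k<N.
        K k (zip_paths k z) \<in> couplings (\<kappa> k (restrict (fst z) {..<k})) (\<kappa>' k (restrict (snd z) {..<k})))}"

definition AW :: "real \<Rightarrow> nat \<Rightarrow> (nat \<Rightarrow> real) measure \<Rightarrow> (nat \<Rightarrow> real) measure \<Rightarrow> real" where
  "AW p N \<mu> \<nu> =
     (INF \<pi>\<in>bicausal N \<mu> \<nu>. cost_root p (\<integral>z. path_cost p N (fst z) (snd z) \<partial>\<pi>))"

definition Cauchy_wrt :: "('a \<Rightarrow> 'a \<Rightarrow> real) \<Rightarrow> (nat \<Rightarrow> 'a) \<Rightarrow> bool" where
  "Cauchy_wrt d X \<longleftrightarrow> (\<forall>\<epsilon>>0. \<exists>M. \<forall>m\<ge>M. \<forall>n\<ge>M. d (X m) (X n) < \<epsilon>)"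

end

theory Submission
  imports Defs
begin

text \<open>
  Let \<open>\<mu> n\<close> be the law of \<open>(X, digit n X, 0, \<dots>, 0)\<close>, where \<open>X\<close> is uniform on the unit interval and
  \<open>digit n\<close> is the \<open>n\<close>-th binary digit (counted from \<open>0\<close>). Swapping the \<open>m\<close>-th and the \<open>n\<close>-th digit of \<open>X\<close> preserves
  Lebesgue measure, moves \<open>X\<close> by at most \<open>2\<^sup>-\<^sup>M\<close> if \<open>M \<le> m, n\<close>, and turns \<open>digit m\<close> into \<open>digit n\<close>;
  the resulting coupling is bicausal because all coordinates are functions of the first one, so
  \<open>AW\<close> of \<open>\<mu> m\<close> and \<open>\<mu> n\<close> is at most \<open>2\<^sup>-\<^sup>M\<close>. In the quantile process of \<open>\<mu> n\<close> the first coordinate is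
  monotone with uniform law, hence the identity, and the second one is \<open>digit n\<close> of it. So \<open>KR\<close>
  compares \<open>digit m\<close> with \<open>digit n\<close> at the same point, and these differ with probability \<open>1/2\<close>.
\<close>

section \<open>Uniform law on the unit interval and measure-preserving translations by finitely many
  steps\<close>

text \<open>The half-open interval, unlike the open one, is stable under flipping a binary digit (which may
  send \<open>1/2\<close> to \<open>0\<close>); distributions on \<open>borel\<close> do not see the difference.\<close>

definition unit_law :: "real measure" where
  "unit_law = uniform_measure lborel {0..<1}"

lemma prob_space_unit_law: "prob_space unit_law"
  unfolding unit_law_def by (rule prob_space_uniform_measure) auto

lemma sets_unit_law [simp, measurable_cong]: "sets unit_law = sets borel"
  by (simp add: unit_law_def)

lemma space_unit_law [simp]: "space unit_law = UNIV"
  by (simp add: unit_law_def)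

lemma AE_unit_law: "AE x in unit_law. 0 \<le> x \<and> x < 1"
  unfolding unit_law_def by (rule AE_uniform_measureI) auto

lemma emeasure_unit_law:
  "A \<in> sets borel \<Longrightarrow> emeasure unit_law A = emeasure lborel ({0..<1} \<inter> A)"
  by (simp add: unit_law_def divide_ennreal_def)

lemma measure_unit_law_atMost:
  assumes "0 \<le> t" "t < 1"
  shows "measure unit_law {..t} = t"
proof -
  have "{0..<1} \<inter> {..t} = {0..t}" using assms by auto
  then show ?thesis using assms by (simp add: measure_def emeasure_unit_law)
qed

lemma prob_space_unit_interval: "prob_space (restrict_space lborel {0<..<1::real})"
  by (rule prob_spaceI) (simp add: emeasure_restrict_space space_restrict_space)

lemma distr_unit_interval:
  "distr (restrict_space lborel {0<..<1::real}) borel (\<lambda>x. x) = unit_law"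
proof (rule measure_eqI)
  fix A :: "real set" assume "A \<in> sets (distr (restrict_space lborel {0<..<1::real}) borel (\<lambda>x. x))"
  then have A: "A \<in> sets borel" by simp
  have "emeasure (distr (restrict_space lborel {0<..<1}) borel (\<lambda>x. x)) A
    = emeasure (restrict_space lborel {0<..<1}) (A \<inter> {0<..<1})"
    using A by (subst emeasure_distr) (auto simp: space_restrict_space intro!: measurable_restrict_space1)
  also have "\<dots> = emeasure lborel (A \<inter> {0<..<1})"
    by (subst emeasure_restrict_space) auto
  \<comment> \<open>The two intervals differ by the point 0 only, which is a null set.\<close>
  also have "\<dots> = emeasure lborel ({0..<1} \<inter> A)"
    using A AE_lborel_singleton[of "0::real"] by (intro emeasure_eq_AE) auto
  finally show "emeasure (distr (restrict_space lborel {0<..<1}) borel (\<lambda>x. x)) A = emeasure unit_law A"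
    using A by (simp add: emeasure_unit_law)
qed simp

text \<open>With \<open>i = 0\<close> this turns integrals over the cube of functions of
  \<open>u 0\<close> into integrals over \<open>unit_law\<close>.\<close>

lemma distr_cube_coordinate:
  assumes "i < N"
  shows "distr (cube_measure N) borel (\<lambda>u. u i) = unit_law"
proof -
  interpret prob_space "restrict_space lborel {0<..<1::real}" by (rule prob_space_unit_interval)
  have [measurable]: "(\<lambda>u. u i) \<in> cube_measure N \<rightarrow>\<^sub>M restrict_space lborel {0<..<1::real}"
    using assms by (auto simp: cube_measure_def)
  have [measurable]: "(\<lambda>x. x) \<in> restrict_space lborel {0<..<1::real} \<rightarrow>\<^sub>M borel"
    by (auto intro: measurable_restrict_space1)
  have "distr (cube_measure N) (restrict_space lborel {0<..<1}) (\<lambda>u. u i) = restrict_space lborel {0<..<1}"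
    unfolding cube_measure_def using assms
    by (intro distr_PiM_component) (auto simp: prob_space_unit_interval)
  then have "unit_law = distr (distr (cube_measure N) (restrict_space lborel {0<..<1}) (\<lambda>u. u i)) borel (\<lambda>x. x)"
    by (simp add: distr_unit_interval)
  also have "\<dots> = distr (cube_measure N) borel (\<lambda>u. u i)"
    by (subst distr_distr) (auto simp: comp_def)
  finally show ?thesis by simp
qed

text \<open>The hypothesis \<open>c (x + c x) = - c x\<close> makes \<open>x \<mapsto> x + c x\<close> an involution that exchanges
  the pieces \<open>{c = a}\<close> and \<open>{c = - a}\<close> by translation.\<close>

lemma distr_lborel_translation_involution:
  fixes c :: "real \<Rightarrow> real"
  assumes c [measurable]: "c \<in> borel_measurable borel"
    and fin: "finite (range c)" and inv: "\<And>x. c (x + c x) = - c x"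
  shows "distr lborel borel (\<lambda>x. x + c x) = lborel"
proof (rule measure_eqI)
  fix A :: "real set" assume "A \<in> sets (distr lborel borel (\<lambda>x. x + c x))"
  then have A [measurable]: "A \<in> sets borel" by simp
  have neg: "uminus ` range c = range c"
  proof -
    have "- c x \<in> range c" for x using inv[of x] by (metis rangeI)
    then show ?thesis by (auto simp: image_iff) (metis minus_minus rangeE)
  qed
  \<comment> \<open>Splitting by the value of \<open>c\<close> replaces the variable shift
    \<open>c x\<close> by a constant one on each of finitely many pieces.\<close>
  have sum: "f x = (\<Sum>a\<in>range c. if c x = a then f x else 0)" for f :: "real \<Rightarrow> ennreal" and x
    using fin by (simp add: sum.delta)
  \<comment> \<open>Translation by \<open>a\<close> maps \<open>{c = a}\<close> into
    \<open>{c = - a}\<close>, and the involution gives the converse, so the image is all of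
    \<open>{c = - a}\<close>.\<close>
  have iff: "c x = a \<longleftrightarrow> c (x + a) = - a" for x a
    using inv[of x] inv[of "x + a"] by auto
  have "emeasure (distr lborel borel (\<lambda>x. x + c x)) A = (\<integral>\<^sup>+x. indicator A (x + c x) \<partial>lborel)"
    by (simp add: nn_integral_distr flip: nn_integral_indicator)
  also have "\<dots> = (\<integral>\<^sup>+x. (\<Sum>a\<in>range c. if c x = a then indicator A (x + a) else 0) \<partial>lborel)"
    by (intro nn_integral_cong, subst sum[of "\<lambda>x. indicator A (x + c x)"]) (auto intro!: sum.cong)
  also have "\<dots> = (\<Sum>a\<in>range c. \<integral>\<^sup>+x. (if c x = a then indicator A (x + a) else 0) \<partial>lborel)"
    by (intro nn_integral_sum) measurable
  also have "\<dots> = (\<Sum>a\<in>range c. \<integral>\<^sup>+x. (if c x = - a then indicator A x else 0) \<partial>lborel)"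
  proof (intro sum.cong refl)
    fix a
    have "(\<integral>\<^sup>+x. (if c x = - a then indicator A x else 0) \<partial>lborel)
      = (\<integral>\<^sup>+x. (if c (a + 1 * x) = - a then indicator A (a + 1 * x) else 0) \<partial>lborel)"
      \<comment> \<open>With factor 1 the affine substitution is translation invariance of Lebesgue
        measure.\<close>
      by (subst nn_integral_real_affine[where c=1 and t=a]) auto
    then show "(\<integral>\<^sup>+x. (if c x = a then indicator A (x + a) else 0) \<partial>lborel)
      = (\<integral>\<^sup>+x. (if c x = - a then indicator A x else 0) \<partial>lborel)"
      unfolding iff[of _ a] by (simp only: mult_1 add.commute[of a])
  qed
  also have "\<dots> = (\<Sum>a\<in>uminus ` range c. \<integral>\<^sup>+x. (if c x = a then indicator A x else 0) \<partial>lborel)"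
    by (subst sum.reindex) auto
  also have "\<dots> = (\<integral>\<^sup>+x. (\<Sum>a\<in>range c. if c x = a then indicator A x else 0) \<partial>lborel)"
    unfolding neg by (intro nn_integral_sum[symmetric]) measurable
  also have "\<dots> = (\<integral>\<^sup>+x. indicator A x \<partial>lborel)"
    by (simp only: sum[symmetric])
  finally show "emeasure (distr lborel borel (\<lambda>x. x + c x)) A = emeasure lborel A" by simp
qed simp

text \<open>The unit interval is the set where the floor is 0. Since the map keeps the floor, it
  leaves this set invariant, and the invariance of Lebesgue measure on the line restricts to
  it.\<close>

lemma distr_unit_law_translation_involution:
  fixes c :: "real \<Rightarrow> real"
  assumes c [measurable]: "c \<in> borel_measurable borel"
    and fin: "finite (range c)" and inv: "\<And>x. c (x + c x) = - c x"
    and fl: "\<And>x. \<lfloor>x + c x\<rfloor> = \<lfloor>x\<rfloor>"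
  shows "distr unit_law borel (\<lambda>x. x + c x) = unit_law"
proof (rule measure_eqI)
  fix A :: "real set" assume "A \<in> sets (distr unit_law borel (\<lambda>x. x + c x))"
  then have A [measurable]: "A \<in> sets borel" by simp
  have I: "{0..<1::real} = {x. \<lfloor>x\<rfloor> = 0}" by (auto simp: floor_eq_iff)
  have "emeasure (distr unit_law borel (\<lambda>x. x + c x)) A
      = emeasure lborel ({0..<1} \<inter> (\<lambda>x. x + c x) -` A)"
    using measurable_sets_borel[of "\<lambda>x. x + c x" borel A]
    by (subst emeasure_distr) (auto simp: emeasure_unit_law)
  also have "{0..<1} \<inter> (\<lambda>x. x + c x) -` A = (\<lambda>x. x + c x) -` ({0..<1} \<inter> A) \<inter> space lborel"
    unfolding I by (auto simp: fl)
  also have "emeasure lborel \<dots> = emeasure (distr lborel borel (\<lambda>x. x + c x)) ({0..<1} \<inter> A)"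
    by (subst emeasure_distr) auto
  also have "\<dots> = emeasure unit_law A"
    unfolding distr_lborel_translation_involution[OF c fin inv] by (simp add: emeasure_unit_law)
  finally show "emeasure (distr unit_law borel (\<lambda>x. x + c x)) A = emeasure unit_law A" .
qed simp

section \<open>Flipping and swapping binary digits\<close>

text \<open>\<open>digit 0\<close> is the digit of weight 1/2. Floor and integer \<open>mod\<close>
  make sense on the whole line, so the identities below hold at every real, as the involution lemmas
  require.\<close>

definition digit :: "nat \<Rightarrow> real \<Rightarrow> real" where
  "digit n x = of_int (\<lfloor>2 ^ Suc n * x\<rfloor> mod 2)"

lemma digit_cases: "digit n x = 0 \<or> digit n x = 1"
  unfolding digit_def by auto

lemma digit_measurable [measurable]: "digit n \<in> borel_measurable borel"
  unfolding digit_def by measurable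

text \<open>The increment is plus the weight of digit \<open>n\<close> if that digit is 0, and minus
  the weight if it is 1. An increment rather than the flipped point is defined in order to fit the
  form \<open>x + c x\<close>.\<close>

definition flip_step :: "nat \<Rightarrow> real \<Rightarrow> real" where
  "flip_step n x = (1 - 2 * digit n x) / 2 ^ Suc n"

lemma flip_step_measurable [measurable]: "flip_step n \<in> borel_measurable borel"
  unfolding flip_step_def by measurable

text \<open>At scale \<open>2 ^ Suc n\<close> the flip adds an integer: it exchanges each even
  integer part with the odd one following it. The effect of a flip on the digits from
  \<open>n\<close> upwards in weight is read off from this.\<close>

lemma floor_scaled_flip:
  "\<lfloor>2 ^ Suc n * (x + flip_step n x)\<rfloor> = \<lfloor>2 ^ Suc n * x\<rfloor> + 1 - 2 * (\<lfloor>2 ^ Suc n * x\<rfloor> mod 2)"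
proof -
  have "2 ^ Suc n * (x + flip_step n x)
    = 2 ^ Suc n * x + of_int (1 - 2 * (\<lfloor>2 ^ Suc n * x\<rfloor> mod 2))"
    by (simp add: flip_step_def digit_def field_simps del: power_Suc)
  then show ?thesis by (simp only: floor_add_int[symmetric])
qed

lemma digit_flip_self: "digit n (x + flip_step n x) = 1 - digit n x"
proof -
  have "(e + 1 - 2 * (e mod 2)) mod 2 = 1 - e mod (2::int)" for e by presburger
  then show ?thesis unfolding digit_def floor_scaled_flip by simp
qed

text \<open>The two integers exchanged by the flip have the same half, rounded down, so all coarser
  floors agree. \<open>j = 0\<close> yields the floor itself, and \<open>j = Suc m\<close> yields
  digit \<open>m\<close> for \<open>m < n\<close>.\<close>

lemma floor_coarse_flip:
  assumes "j \<le> n"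
  shows "\<lfloor>2 ^ j * (x + flip_step n x)\<rfloor> = \<lfloor>2 ^ j * x\<rfloor>"
proof -
  \<comment> \<open>One division by 2 is kept apart because it alone absorbs the flip.\<close>
  have *: "\<lfloor>2 ^ j * y\<rfloor> = \<lfloor>2 ^ Suc n * y\<rfloor> div 2 div 2 ^ (n - j)" for y :: real
  proof -
    have "2 ^ Suc n = (2::real) ^ j * 2 ^ Suc (n - j)"
      using assms by (simp flip: power_add)
    then have "2 ^ j * y = (2 ^ Suc n * y) / real_of_int (2 ^ Suc (n - j))"
      by (simp add: field_simps)
    then have "\<lfloor>2 ^ j * y\<rfloor> = \<lfloor>2 ^ Suc n * y\<rfloor> div 2 ^ Suc (n - j)"
      by (simp only: floor_divide_real_eq_div zero_le_power zero_le_numeral)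
    then show ?thesis by (simp add: zdiv_zmult2_eq)
  qed
  have "(e + 1 - 2 * (e mod 2)) div 2 = e div (2::int)" for e by presburger
  then show ?thesis unfolding * floor_scaled_flip by simp
qed

lemma floor_flip: "\<lfloor>x + flip_step n x\<rfloor> = \<lfloor>x\<rfloor>"
  using floor_coarse_flip[of 0 n x] by simp

lemma digit_flip_other:
  assumes "m \<noteq> n"
  shows "digit m (x + flip_step n x) = digit m x"
proof (cases "m < n")
  case True
  then show ?thesis using floor_coarse_flip[of "Suc m" n x] by (simp add: digit_def)
next
  case False
  then have mn: "n < m" using assms by simp
  \<comment> \<open>For a finer digit the flip is, at scale \<open>2 ^ Suc m\<close>, a shift by an
    even integer, which parity does not see.\<close>
  define s :: int where "s = 1 - 2 * (\<lfloor>2 ^ Suc n * x\<rfloor> mod 2)"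
  have "Suc m = Suc n + (m - n)" using mn by simp
  then have "2 ^ Suc m = (2::real) ^ Suc n * 2 ^ (m - n)"
    by (simp only: power_add)
  then have "2 ^ Suc m * (x + flip_step n x) = 2 ^ Suc m * x + of_int (2 ^ (m - n) * s)"
    by (simp add: flip_step_def digit_def s_def field_simps)
  then have "\<lfloor>2 ^ Suc m * (x + flip_step n x)\<rfloor> = \<lfloor>2 ^ Suc m * x\<rfloor> + 2 ^ (m - n) * s"
    by (simp only: floor_add_int)
  moreover have "even (2 ^ (m - n) * s)" using mn by simp
  moreover have "(a + b) mod 2 = a mod (2::int)" if "even b" for a b
    using that by presburger
  ultimately show ?thesis unfolding digit_def by presburger
qed

text \<open>Supplies the finite range of steps for flips (with \<open>m = n\<close>) and for
  swaps.\<close>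

lemma finite_range_digits:
  "finite (range (\<lambda>x. h (digit m x) (digit n x)))"
proof (rule finite_subset)
  show "range (\<lambda>x. h (digit m x) (digit n x)) \<subseteq> {h 0 0, h 0 1, h 1 0, h 1 1}"
  proof (rule image_subsetI)
    fix x
    show "h (digit m x) (digit n x) \<in> {h 0 0, h 0 1, h 1 0, h 1 1}"
      using digit_cases[of m x] digit_cases[of n x] by auto
  qed
qed simp

lemma distr_unit_law_flip: "distr unit_law borel (\<lambda>x. x + flip_step n x) = unit_law"
proof (rule distr_unit_law_translation_involution)
  show "finite (range (flip_step n))"
    using finite_range_digits[of "\<lambda>a b. (1 - 2 * a) / 2 ^ Suc n" n n]
    by (simp only: flip_step_def[abs_def])
  show "flip_step n (x + flip_step n x) = - flip_step n x" for x
    unfolding flip_step_def[of n "x + flip_step n x"] digit_flip_self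
    by (simp add: flip_step_def field_simps)
qed (auto simp: floor_flip)

text \<open>Digit \<open>k\<close> has weight \<open>1 / 2 ^ Suc k\<close>. If the digits differ,
  one weight is removed and the other added; if they agree, the step is 0.\<close>

definition swap_step :: "nat \<Rightarrow> nat \<Rightarrow> real \<Rightarrow> real" where
  "swap_step m n x = (digit m x - digit n x) * (1 / 2 ^ Suc n - 1 / 2 ^ Suc m)"

lemma swap_step_measurable [measurable]: "swap_step m n \<in> borel_measurable borel"
  unfolding swap_step_def by measurable

text \<open>Swapping two different binary digits means flipping both. Flipping digit
  \<open>m\<close> leaves digit \<open>n\<close>, hence also \<open>flip_step n\<close>, unchanged,
  so the two increments add up.\<close>

lemma swap_eq_flips:
  assumes "digit m x \<noteq> digit n x"
  shows "x + swap_step m n x = (x + flip_step m x) + flip_step n (x + flip_step m x)"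
proof -
  have "m \<noteq> n" using assms by auto
  then have "flip_step n (x + flip_step m x) = flip_step n x"
    by (simp add: flip_step_def[of n] digit_flip_other del: power_Suc)
  then show ?thesis using assms digit_cases[of m x] digit_cases[of n x]
    by (auto simp: swap_step_def flip_step_def)
qed

lemma swap_digits:
  shows "digit m (x + swap_step m n x) = digit n x" "digit n (x + swap_step m n x) = digit m x"
    and "\<lfloor>x + swap_step m n x\<rfloor> = \<lfloor>x\<rfloor>"
proof -
  have "digit m (x + swap_step m n x) = digit n x \<and> digit n (x + swap_step m n x) = digit m x
     \<and> \<lfloor>x + swap_step m n x\<rfloor> = \<lfloor>x\<rfloor>"
  proof (cases "digit m x = digit n x")
    case True
    then show ?thesis by (simp add: swap_step_def)
  next
    case False
    then have "m \<noteq> n" by auto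
    then show ?thesis using False digit_cases[of m x] digit_cases[of n x]
      unfolding swap_eq_flips[OF False]
      by (auto simp: digit_flip_self digit_flip_other floor_flip)
  qed
  then show "digit m (x + swap_step m n x) = digit n x" "digit n (x + swap_step m n x) = digit m x"
    "\<lfloor>x + swap_step m n x\<rfloor> = \<lfloor>x\<rfloor>" by auto
qed

text \<open>After the swap the difference of the two digits has changed sign, and with it the step;
  this is the involution condition.\<close>

lemma distr_unit_law_swap: "distr unit_law borel (\<lambda>x. x + swap_step m n x) = unit_law"
proof (rule distr_unit_law_translation_involution)
  show "finite (range (swap_step m n))"
    using finite_range_digits[of "\<lambda>a b. (a - b) * (1 / 2 ^ Suc n - 1 / 2 ^ Suc m)" m n]
    by (simp only: swap_step_def[abs_def])
  show "swap_step m n (x + swap_step m n x) = - swap_step m n x" for x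
    unfolding swap_step_def[of m n "x + swap_step m n x"] swap_digits
    unfolding swap_step_def by (simp only: mult_minus_left[symmetric] minus_diff_eq)
qed (auto simp: swap_digits)

lemma abs_swap_step_le:
  assumes "M \<le> m" "M \<le> n"
  shows "\<bar>swap_step m n x\<bar> \<le> (1 / 2) ^ M"
proof -
  have "\<bar>1 / 2 ^ Suc n - 1 / 2 ^ Suc m\<bar> \<le> (1 / 2 :: real) ^ M"
  proof -
    have *: "0 \<le> 1 / (2::real) ^ Suc k \<and> 1 / (2::real) ^ Suc k \<le> (1 / 2) ^ M" if "M \<le> k" for k
      using power_decreasing[of M "Suc k" "1 / 2 :: real"] that by (simp add: power_one_over)
    show ?thesis using *[OF assms(1)] *[OF assms(2)] by linarith
  qed
  moreover have "\<bar>digit m x - digit n x\<bar> \<le> 1"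
    using digit_cases[of m x] digit_cases[of n x] by auto
  ultimately have "\<bar>digit m x - digit n x\<bar> * \<bar>1 / 2 ^ Suc n - 1 / 2 ^ Suc m\<bar> \<le> 1 * (1 / 2) ^ M"
    by (intro mult_mono) auto
  then show ?thesis by (simp add: swap_step_def abs_mult)
qed

text \<open>Flipping digit \<open>n\<close> preserves the measure and exchanges the event that the
  digits differ with its complement, so both have the same probability.\<close>

lemma measure_digits_differ:
  assumes "m \<noteq> n"
  shows "measure unit_law {x. digit m x \<noteq> digit n x} = 1 / 2"
proof -
  interpret prob_space unit_law by (rule prob_space_unit_law)
  let ?D = "{x. digit m x \<noteq> digit n x}"
  have D [measurable]: "?D \<in> sets borel" by measurable
  have "prob ?D = measure (distr unit_law borel (\<lambda>x. x + flip_step n x)) ?D"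
    by (simp add: distr_unit_law_flip)
  also have "\<dots> = prob ((\<lambda>x. x + flip_step n x) -` ?D \<inter> space unit_law)"
    by (rule measure_distr) auto
  also have "(\<lambda>x. x + flip_step n x) -` ?D \<inter> space unit_law = space unit_law - ?D"
  proof -
    have "a \<noteq> 1 - b \<longleftrightarrow> a = b" if "a = 0 \<or> a = 1" "b = 0 \<or> b = 1" for a b :: real
      using that by auto
    from this[OF digit_cases digit_cases] show ?thesis
      using assms by (auto simp: digit_flip_self digit_flip_other)
  qed
  also have "prob \<dots> = 1 - prob ?D" by (intro prob_compl) auto
  finally show ?thesis by simp
qed

section \<open>Measurability on path spaces and disintegrations with Dirac kernels\<close>

lemma measurable_path_component:
  assumes "i < N"
  shows "(\<lambda>x. x i) \<in> path_space N \<rightarrow>\<^sub>M borel"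
  using assms by (simp add: path_space_def)

lemma measurable_restrict_path:
  assumes "k \<le> N"
  shows "(\<lambda>x. restrict x {..<k}) \<in> path_space N \<rightarrow>\<^sub>M path_space k"
  using assms unfolding path_space_def by (intro measurable_restrict_subset) auto

lemma measurable_append_path:
  assumes g [measurable]: "g \<in> M \<rightarrow>\<^sub>M borel" and f: "f \<in> M \<rightarrow>\<^sub>M path_space k"
  shows "(\<lambda>x. (f x)(k := g x)) \<in> M \<rightarrow>\<^sub>M path_space (Suc k)"
proof -
  have [measurable]: "f \<in> M \<rightarrow>\<^sub>M PiM {..<k} (\<lambda>_. borel)" using f by (simp add: path_space_def)
  show ?thesis unfolding path_space_def lessThan_Suc by measurable
qed

lemma prob_space_return_borel: "prob_space (return borel c)"
  by (rule prob_space_return) simp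

text \<open>If each later coordinate is almost surely a function of the preceding ones, its
  conditional law is a Dirac mass. The coordinate type is left general so that the result covers the
  marginals as well as the zipped coupling, whose coordinates are pairs.\<close>

lemma disintegration_of_deterministic_tail:
  fixes \<mu> :: "(nat \<Rightarrow> 'a::topological_space) measure"
  assumes \<mu>: "\<mu> \<in> space (prob_algebra (path_space N))"
    and g: "\<And>k. 0 < k \<Longrightarrow> k < N \<Longrightarrow> g k \<in> path_space k \<rightarrow>\<^sub>M borel"
    and ae: "\<And>k. 0 < k \<Longrightarrow> k < N \<Longrightarrow> AE x in \<mu>. x k = g k (restrict x {..<k})"
  shows "disintegration N \<mu> (\<lambda>k x. if k = 0 then distr \<mu> borel (\<lambda>x. x 0) else return borel (g k x))"
  unfolding disintegration_def
proof (intro allI impI conjI)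
  fix k assume k: "k < N"
  interpret prob_space \<mu> using \<mu> by (simp add: space_prob_algebra)
  have sets_\<mu> [measurable_cong]: "sets \<mu> = sets (path_space N)"
    using \<mu> by (simp add: space_prob_algebra)
  note g' [measurable] = g[OF _ k]
  have [measurable]: "(\<lambda>x. x k) \<in> \<mu> \<rightarrow>\<^sub>M borel" "(\<lambda>x. x 0) \<in> \<mu> \<rightarrow>\<^sub>M borel"
    using k measurable_path_component[of k N, where 'a='a] measurable_path_component[of 0 N, where 'a='a]
      measurable_cong_sets[OF sets_\<mu> refl] by auto
  have r [measurable]: "(\<lambda>x. restrict x {..<k}) \<in> \<mu> \<rightarrow>\<^sub>M path_space k"
      "(\<lambda>x. restrict x {..<Suc k}) \<in> \<mu> \<rightarrow>\<^sub>M path_space (Suc k)"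
    using k measurable_restrict_path[of k N, where 'a='a] measurable_restrict_path[of "Suc k" N, where 'a='a]
      measurable_cong_sets[OF sets_\<mu> refl] by auto
  let ?\<kappa> = "\<lambda>k x. if k = 0 then distr \<mu> borel (\<lambda>x. x 0) else return borel (g k x)"
  have p0: "prob_space (distr \<mu> borel (\<lambda>x. x 0))"
    by (rule prob_space_distr) measurable
  show \<kappa>: "?\<kappa> k \<in> path_space k \<rightarrow>\<^sub>M prob_algebra borel"
  proof (cases "k = 0")
    case True
    then show ?thesis using p0 by (auto simp: space_prob_algebra)
  next
    case False
    then show ?thesis
      using measurable_compose[OF g' measurable_return_prob_space] by simp
  qed
  let ?A = "\<lambda>x y. return (path_space (Suc k)) (x(k := y))"
  have A: "(\<lambda>(x, y). ?A x y) \<in> path_space k \<Otimes>\<^sub>M borel \<rightarrow>\<^sub>M prob_algebra (path_space (Suc k))"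
    unfolding case_prod_beta
    by (intro measurable_compose[OF measurable_append_path measurable_return_prob_space]) auto
  have N: "(\<lambda>x. ?\<kappa> k x \<bind> ?A x) \<in> path_space k \<rightarrow>\<^sub>M subprob_algebra (path_space (Suc k))"
    by (rule measurable_prob_algebraD, rule measurable_bind_prob_space2[OF \<kappa> A])
  have "distr \<mu> (path_space k) (\<lambda>x. restrict x {..<k}) \<bind> (\<lambda>x. ?\<kappa> k x \<bind> ?A x)
    = \<mu> \<bind> (\<lambda>x. ?\<kappa> k (restrict x {..<k}) \<bind> ?A (restrict x {..<k}))"
    by (rule bind_distr[OF r(1) N not_empty])
  also have "\<dots> = distr \<mu> (path_space (Suc k)) (\<lambda>x. restrict x {..<Suc k})"
  proof (cases "k = 0")
    \<comment> \<open>The empty prefix carries no information: the kernel does not vary with it, so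
      the outer bind over the probability measure \<open>\<mu>\<close> disappears.\<close>
    case True
    have m: "(\<lambda>y. (\<lambda>_. undefined)(0 := y)) \<in> borel \<rightarrow>\<^sub>M path_space (Suc 0)"
      by (rule measurable_append_path[where f="\<lambda>_ _. undefined"])
        (auto simp: path_space_def space_PiM)
    have 0: "restrict x {..<0} = (\<lambda>_. undefined)" "restrict x {..<Suc 0} = (\<lambda>_. undefined)(0 := x 0)"
      for x :: "nat \<Rightarrow> 'a" by auto
    have "distr \<mu> borel (\<lambda>x. x 0) \<bind> (\<lambda>y. return (path_space (Suc 0)) ((\<lambda>_. undefined)(0 := y)))
      = distr \<mu> (path_space (Suc 0)) (\<lambda>x. (\<lambda>_. undefined)(0 := x 0))"
      using m not_empty by (intro bind_distr_return) auto
    moreover have "prob_space (distr \<mu> (path_space (Suc 0)) (\<lambda>x. (\<lambda>_. undefined)(0 := x 0)))"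
      by (rule prob_space_distr) (auto intro: measurable_compose[OF _ m])
    ultimately show ?thesis
      using True bind_const'[OF prob_space_axioms prob_space_imp_subprob_space]
      by (simp only: 0 if_True simp_thms)
  next
    case False
    then have "\<mu> \<bind> (\<lambda>x. ?\<kappa> k (restrict x {..<k}) \<bind> ?A (restrict x {..<k}))
      = \<mu> \<bind> (\<lambda>x. return (path_space (Suc k)) ((restrict x {..<k})(k := g k (restrict x {..<k}))))"
    proof (intro bind_cong refl)
      fix x assume "x \<in> space \<mu>"
      then have x: "restrict x {..<k} \<in> space (path_space k)" using r(1) by (rule measurable_space[rotated])
      have "return borel (g k (restrict x {..<k})) \<bind> ?A (restrict x {..<k}) = ?A (restrict x {..<k}) (g k (restrict x {..<k}))"
        using x by (intro bind_return[where N="path_space (Suc k)"] measurable_compose[OF measurable_append_path return_measurable])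
          auto
      then show "?\<kappa> k (restrict x {..<k}) \<bind> ?A (restrict x {..<k})
          = return (path_space (Suc k)) ((restrict x {..<k})(k := g k (restrict x {..<k})))"
        using False by simp
    qed
    also have "\<dots> = distr \<mu> (path_space (Suc k)) (\<lambda>x. (restrict x {..<k})(k := g k (restrict x {..<k})))"
      using False by (intro bind_return_distr' not_empty measurable_append_path) measurable
    also have "\<dots> = distr \<mu> (path_space (Suc k)) (\<lambda>x. restrict x {..<Suc k})"
    \<comment> \<open>Appending the predicted coordinate to the prefix almost surely gives back the
      actual longer prefix.\<close>
    proof (intro distr_cong_AE refl)
      show "AE x in \<mu>. (restrict x {..<k})(k := g k (restrict x {..<k})) = restrict x {..<Suc k}"
        using ae[of k] False k
        by (auto simp: fun_eq_iff restrict_def less_Suc_eq elim!: eventually_mono)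
      show "(\<lambda>x. (restrict x {..<k})(k := g k (restrict x {..<k}))) \<in> \<mu> \<rightarrow>\<^sub>M path_space (Suc k)"
        using False by (intro measurable_append_path) measurable
    qed measurable
    finally show ?thesis .
  qed
  finally show "distr \<mu> (path_space (Suc k)) (\<lambda>x. restrict x {..<Suc k}) =
      distr \<mu> (path_space k) (\<lambda>x. restrict x {..<k}) \<bind> (\<lambda>x. ?\<kappa> k x \<bind> ?A x)" by simp
qed

section \<open>Laws carried by the graph of a function\<close>

definition graph_path :: "nat \<Rightarrow> (real \<Rightarrow> real) \<Rightarrow> real \<Rightarrow> nat \<Rightarrow> real" where
  "graph_path N f x = (\<lambda>i\<in>{..<N}. if i = 0 then x else if i = 1 then f x else 0)"

definition graph_law :: "nat \<Rightarrow> (real \<Rightarrow> real) \<Rightarrow> (nat \<Rightarrow> real) measure" where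
  "graph_law N f = distr unit_law (path_space N) (graph_path N f)"

lemma graph_path_measurable [measurable]:
  assumes [measurable]: "f \<in> borel_measurable borel"
  shows "graph_path N f \<in> borel \<rightarrow>\<^sub>M path_space N"
  unfolding graph_path_def path_space_def by measurable

lemma graph_path_measurable_unit_law [measurable]:
  "f \<in> borel_measurable borel \<Longrightarrow> graph_path N f \<in> unit_law \<rightarrow>\<^sub>M path_space N"
  by (simp add: graph_path_measurable measurable_cong_sets[OF sets_unit_law refl])

lemma sets_graph_law [simp, measurable_cong]: "sets (graph_law N f) = sets (path_space N)"
  by (simp add: graph_law_def)

lemma prob_space_graph_law:
  assumes [measurable]: "f \<in> borel_measurable borel"
  shows "prob_space (graph_law N f)"
  unfolding graph_law_def
  by (intro prob_space.prob_space_distr prob_space_unit_law graph_path_measurable_unit_law assms)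

lemma AE_graph_law:
  assumes f: "f \<in> borel_measurable borel" and k: "0 < k" "k < N"
  shows "AE x in graph_law N f. x k = (if k = 1 then f (x 0) else 0)"
proof -
  have "(\<lambda>x. f (x 0)) \<in> path_space N \<rightarrow>\<^sub>M borel"
    using k by (intro measurable_compose[OF measurable_path_component f]) simp
  then have g: "(\<lambda>x. if k = 1 then f (x 0) else 0) \<in> path_space N \<rightarrow>\<^sub>M borel"
    by (cases "k = 1") simp_all
  have "{x \<in> space (path_space N). x k = (if k = 1 then f (x 0) else 0)} \<in> sets (path_space N)"
    by (intro measurable_equality_set measurable_path_component k g)
  then show ?thesis
    unfolding graph_law_def using k
    by (subst AE_distr_iff[OF graph_path_measurable_unit_law[OF f]]) (simp_all add: graph_path_def)
qed

lemma distr_graph_law_first: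
  assumes f: "f \<in> borel_measurable borel" and N: "0 < N"
  shows "distr (graph_law N f) borel (\<lambda>x. x 0) = unit_law"
proof -
  have "distr (graph_law N f) borel (\<lambda>x. x 0) = distr unit_law borel (\<lambda>x. graph_path N f x 0)"
    unfolding graph_law_def
    by (subst distr_distr[OF measurable_path_component[OF N] graph_path_measurable_unit_law[OF f]])
      (simp add: comp_def)
  also have "\<dots> = distr unit_law unit_law (\<lambda>x. x)"
    using N by (intro distr_cong) (auto simp: graph_path_def)
  finally show ?thesis by (simp add: distr_id)
qed

section \<open>Path costs and bicausal couplings of graph laws\<close>

lemma path_cost_measurable [measurable]:
  "(\<lambda>z. path_cost p N (fst z) (snd z)) \<in> path_space N \<Otimes>\<^sub>M path_space N \<rightarrow>\<^sub>M borel"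
  unfolding path_cost_def L2_set_def path_space_def by measurable

lemma path_cost_nonneg: "0 \<le> path_cost p N x y"
  by (auto simp: path_cost_def intro!: sum_nonneg)

lemma cost_root_nonneg: "0 \<le> c \<Longrightarrow> 0 \<le> cost_root p c"
  by (simp add: cost_root_def)

text \<open>At time 0 the kernel is the law of \<open>(x, T x)\<close>, which couples
  \<open>unit_law\<close> with itself because \<open>T\<close> preserves it. At later times all
  kernels are Dirac masses, and the Dirac mass at a pair couples the Dirac masses at its
  entries.\<close>

lemma graph_coupling_bicausal:
  fixes f h T :: "real \<Rightarrow> real"
  assumes f [measurable]: "f \<in> borel_measurable borel" and h [measurable]: "h \<in> borel_measurable borel"
    and T [measurable]: "T \<in> borel_measurable borel" and pres: "distr unit_law borel T = unit_law"
    and N: "2 \<le> N"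
  shows "distr unit_law (path_space N \<Otimes>\<^sub>M path_space N) (\<lambda>x. (graph_path N f x, graph_path N h (T x)))
    \<in> bicausal N (graph_law N f) (graph_law N h)"
proof -
  interpret U: prob_space unit_law by (rule prob_space_unit_law)
  let ?P = "\<lambda>x. (graph_path N f x, graph_path N h (T x))"
  let ?\<pi> = "distr unit_law (path_space N \<Otimes>\<^sub>M path_space N) ?P"
  let ?Z = "distr ?\<pi> (path_space N) (zip_paths N) :: (nat \<Rightarrow> real \<times> real) measure"
  let ?g = "\<lambda>f k x. if k = 1 then f (x 0) else 0 :: real"
  \<comment> \<open>The pair at time \<open>k\<close> of the zipped path, as a function of the
    initial pair: \<open>(f x, h (T x))\<close> at time 1 and zeros afterwards.\<close>
  let ?G = "\<lambda>k z. if k = 1 then (f (fst (z 0)), h (snd (z 0))) else (0, 0)"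
  let ?\<kappa> = "\<lambda>f k x. if k = 0 then distr (graph_law N f) borel (\<lambda>x. x 0) else return borel (?g f k x)"
  let ?K = "\<lambda>k z. if k = 0 then distr ?Z borel (\<lambda>z. z 0) else return borel (?G k z)"
  have T_unit: "T \<in> unit_law \<rightarrow>\<^sub>M borel"
    by (simp add: measurable_cong_sets[OF sets_unit_law refl])
  have P [measurable]: "?P \<in> unit_law \<rightarrow>\<^sub>M path_space N \<Otimes>\<^sub>M path_space N" by measurable
  have N0: "0 < N" using N by simp
  have coz [measurable]: "(\<lambda>x. x 0) \<in> path_space N \<rightarrow>\<^sub>M (borel :: (real \<times> real) measure)"
    using N by (intro measurable_path_component) simp
  have zip [measurable]: "zip_paths N \<in> path_space N \<Otimes>\<^sub>M path_space N \<rightarrow>\<^sub>M (path_space N :: (nat \<Rightarrow> real \<times> real) measure)"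
    unfolding zip_paths_def path_space_def borel_prod[symmetric] by measurable
  note first = distr_graph_law_first[OF _ N0]
  have Z: "?Z = distr unit_law (path_space N) (\<lambda>x. zip_paths N (?P x))"
    by (subst distr_distr[OF zip P]) (simp add: comp_def)
  have Z0: "distr ?Z borel (\<lambda>z. z 0) = distr unit_law borel (\<lambda>x. (x, T x))"
  proof -
    have "distr ?Z borel (\<lambda>z. z 0) = distr unit_law borel (\<lambda>x. zip_paths N (?P x) 0)"
      unfolding Z by (subst distr_distr[OF coz measurable_compose[OF P zip]]) (simp add: comp_def)
    also have "\<dots> = distr unit_law borel (\<lambda>x. (x, T x))"
      using N by (intro distr_cong) (auto simp: graph_path_def zip_paths_def)
    finally show ?thesis .
  qed
  have sets_pair: "sets (A \<Otimes>\<^sub>M B) = sets (borel :: (real \<times> real) measure)"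
    if "sets A = sets borel" "sets B = sets borel" for A B :: "real measure"
    using sets_pair_measure_cong[OF that] by (simp only: borel_prod)
  have fst_snd_borel: "fst \<in> (borel :: (real \<times> real) measure) \<rightarrow>\<^sub>M borel" "snd \<in> (borel :: (real \<times> real) measure) \<rightarrow>\<^sub>M borel"
    using measurable_fst[of "borel :: real measure" "borel :: real measure"]
      measurable_snd[of "borel :: real measure" "borel :: real measure"]
    by (simp_all only: borel_prod)
  then have fst_snd: "fst \<in> (borel :: (real \<times> real) measure) \<rightarrow>\<^sub>M unit_law" "snd \<in> (borel :: (real \<times> real) measure) \<rightarrow>\<^sub>M unit_law"
    by (simp_all only: measurable_cong_sets[OF refl sets_unit_law])
  have pair: "(\<lambda>x. (x, T x)) \<in> unit_law \<rightarrow>\<^sub>M borel"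
    by (intro borel_measurable_Pair) (simp_all add: measurable_cong_sets[OF sets_unit_law refl] T)
  have couple0: "distr unit_law borel (\<lambda>x. (x, T x)) \<in> couplings unit_law unit_law"
  proof -
    have "distr (distr unit_law borel (\<lambda>x. (x, T x))) unit_law fst = distr unit_law unit_law (\<lambda>x. x)"
      by (subst distr_distr[OF fst_snd(1) pair]) (simp add: comp_def)
    moreover have "distr (distr unit_law borel (\<lambda>x. (x, T x))) unit_law snd = distr unit_law borel T"
      by (subst distr_distr[OF fst_snd(2) pair]) (simp add: comp_def cong: distr_cong)
    ultimately show ?thesis
      by (simp add: couplings_def space_prob_algebra sets_pair pres distr_id U.prob_space_distr pair)
  qed
  have couple: "return borel (a, b) \<in> couplings (return borel a) (return borel b)" for a b :: real
  proof -
    have "distr (return borel (a, b)) (return borel a) fst = distr (return borel (a, b)) borel fst"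
      "distr (return borel (a, b)) (return borel b) snd = distr (return borel (a, b)) borel snd"
      by (rule distr_cong; simp)+
    then have "distr (return borel (a, b)) (return borel a) fst = return borel a"
      "distr (return borel (a, b)) (return borel b) snd = return borel b"
      by (simp_all add: distr_return[OF fst_snd_borel(1)] distr_return[OF fst_snd_borel(2)])
    then show ?thesis
      by (simp add: couplings_def space_prob_algebra sets_pair prob_space_return_borel)
  qed
  have dis: "disintegration N (graph_law N f) (?\<kappa> f)" if [measurable]: "f \<in> borel_measurable borel" for f
  proof (rule disintegration_of_deterministic_tail)
    show "graph_law N f \<in> space (prob_algebra (path_space N))"
      by (simp add: space_prob_algebra prob_space_graph_law)
    fix k assume k: "0 < k" "k < N"
    then have [measurable]: "(\<lambda>x. x 0) \<in> path_space k \<rightarrow>\<^sub>M (borel :: real measure)"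
      by (intro measurable_path_component)
    show "?g f k \<in> path_space k \<rightarrow>\<^sub>M borel" by measurable
    show "AE x in graph_law N f. x k = ?g f k (restrict x {..<k})"
      using AE_graph_law[OF that k] k by (cases "k = 1") simp_all
  qed
  have disZ: "disintegration N ?Z ?K"
  proof (rule disintegration_of_deterministic_tail)
    show "?Z \<in> space (prob_algebra (path_space N))"
      unfolding space_prob_algebra
      by (intro CollectI conjI prob_space.prob_space_distr[OF U.prob_space_distr[OF P]] sets_distr)
        (simp add: zip)
    fix k assume k: "0 < k" "k < N"
    then have k0: "(\<lambda>x. x 0) \<in> path_space k \<rightarrow>\<^sub>M (borel :: (real \<times> real) measure)"
      by (intro measurable_path_component)
    show G: "?G k \<in> path_space k \<rightarrow>\<^sub>M borel"
      using measurable_compose[OF measurable_compose[OF k0 fst_snd_borel(1)] f]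
        measurable_compose[OF measurable_compose[OF k0 fst_snd_borel(2)] h]
      by (cases "k = 1") (simp_all add: borel_measurable_Pair)
    have "{z \<in> space (path_space N). z k = ?G k (restrict z {..<k})} \<in> sets (path_space N)"
      using k by (intro measurable_equality_set measurable_path_component
          measurable_compose[OF measurable_restrict_path G]) auto
    then show "AE z in ?Z. z k = ?G k (restrict z {..<k})"
      unfolding Z using k
      by (subst AE_distr_iff[OF measurable_compose[OF P zip]]) (simp_all add: zip_paths_def graph_path_def)
  qed
  have cpl: "?\<pi> \<in> couplings (graph_law N f) (graph_law N h)"
  proof -
    have "distr ?\<pi> (graph_law N f) fst = distr ?\<pi> (path_space N) fst"
      by (rule distr_cong) simp_all
    also have "\<dots> = distr unit_law (path_space N) (graph_path N f)"
      by (subst distr_distr[OF measurable_fst P]) (simp add: comp_def)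
    also have "\<dots> = graph_law N f"
      by (rule graph_law_def[symmetric])
    finally have 1: "distr ?\<pi> (graph_law N f) fst = graph_law N f" .
    have "distr ?\<pi> (graph_law N h) snd = distr ?\<pi> (path_space N) snd"
      by (rule distr_cong) simp_all
    also have "\<dots> = distr unit_law (path_space N) (graph_path N h \<circ> T)"
      by (subst distr_distr[OF measurable_snd P]) (simp add: comp_def)
    also have "\<dots> = distr (distr unit_law borel T) (path_space N) (graph_path N h)"
      by (rule distr_distr[OF graph_path_measurable[OF h], symmetric]) (simp add: T_unit)
    also have "\<dots> = graph_law N h"
      unfolding pres by (rule graph_law_def[symmetric])
    finally have 2: "distr ?\<pi> (graph_law N h) snd = graph_law N h" .
    have 3: "sets ?\<pi> = sets (graph_law N f \<Otimes>\<^sub>M graph_law N h)"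
      unfolding sets_distr by (rule sets_pair_measure_cong[OF sets_graph_law sets_graph_law, symmetric])
    show ?thesis
      unfolding couplings_def space_prob_algebra
      by (intro CollectI conjI 1 2 3 U.prob_space_distr[OF P])
  qed
  \<comment> \<open>For these explicit kernels the coupling property holds at every
    \<open>z\<close>, not merely almost everywhere.\<close>
  have ae: "AE z in ?\<pi>. \<forall>k<N. ?K k (zip_paths k z)
      \<in> couplings (?\<kappa> f k (restrict (fst z) {..<k})) (?\<kappa> h k (restrict (snd z) {..<k}))"
  proof (intro AE_I2 allI impI)
    fix z k
    show "?K k (zip_paths k z)
        \<in> couplings (?\<kappa> f k (restrict (fst z) {..<k})) (?\<kappa> h k (restrict (snd z) {..<k}))"
      using couple0 couple unfolding first[OF f] first[OF h] Z0
      by (cases "k = 0"; cases "k = 1") (simp_all add: zip_paths_def)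
  qed
  show "?\<pi> \<in> bicausal N (graph_law N f) (graph_law N h)"
    unfolding bicausal_def mem_Collect_eq
    by (intro conjI cpl exI[of _ "?\<kappa> f"] exI[of _ "?\<kappa> h"] exI[of _ ?K] dis[OF f] dis[OF h] disZ ae)
qed

lemma AW_le_coupling:
  fixes f h T :: "real \<Rightarrow> real"
  assumes f [measurable]: "f \<in> borel_measurable borel" and h [measurable]: "h \<in> borel_measurable borel"
    and T [measurable]: "T \<in> borel_measurable borel" and pres: "distr unit_law borel T = unit_law"
    and N: "2 \<le> N"
  shows "AW p N (graph_law N f) (graph_law N h)
    \<le> cost_root p (\<integral>x. path_cost p N (graph_path N f x) (graph_path N h (T x)) \<partial>unit_law)"
proof -
  let ?P = "\<lambda>x. (graph_path N f x, graph_path N h (T x))"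
  let ?\<pi> = "distr unit_law (path_space N \<Otimes>\<^sub>M path_space N) ?P"
  let ?C = "\<lambda>\<pi>. cost_root p (\<integral>z. path_cost p N (fst z) (snd z) \<partial>\<pi>)"
  have P: "?P \<in> unit_law \<rightarrow>\<^sub>M path_space N \<Otimes>\<^sub>M path_space N" by measurable
  \<comment> \<open>An infimum of reals lies below each member only once a lower bound is known;
    here it is 0.\<close>
  have bdd: "bdd_below (?C ` bicausal N (graph_law N f) (graph_law N h))"
    by (intro bdd_belowI2[of _ 0] cost_root_nonneg integral_nonneg_AE AE_I2 path_cost_nonneg)
  have "AW p N (graph_law N f) (graph_law N h) \<le> ?C ?\<pi>"
    unfolding AW_def by (rule cINF_lower[OF bdd graph_coupling_bicausal[OF assms]])
  also have "(\<integral>z. path_cost p N (fst z) (snd z) \<partial>?\<pi>)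
      = (\<integral>x. path_cost p N (graph_path N f x) (graph_path N h (T x)) \<partial>unit_law)"
    by (subst integral_distr[OF P path_cost_measurable]) simp
  finally show ?thesis .
qed

lemma sum_first_two:
  fixes g :: "nat \<Rightarrow> 'b::comm_monoid_add"
  assumes "2 \<le> N" and "\<And>i. 2 \<le> i \<Longrightarrow> g i = 0"
  shows "(\<Sum>i<N. g i) = g 0 + g 1"
proof -
  have "(\<Sum>i<N. g i) = sum g {0, 1}"
  proof (rule sum.mono_neutral_right)
    show "\<forall>i\<in>{..<N} - {0, 1}. g i = 0"
      using assms(2) by (metis DiffD2 One_nat_def insertCI less_2_cases not_less)
  qed (use assms(1) in auto)
  then show ?thesis by simp
qed

text \<open>By \<open>eq\<close> at most one coordinate difference is nonzero, so the Euclidean norm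
  and the sum of powers both reduce to the single number \<open>d\<close>. Under the digit swap the
  second coordinates agree; in the comparison of quantile processes the first ones do.\<close>

lemma path_cost_graph:
  assumes N: "2 \<le> N" and d: "d = \<bar>x - y\<bar> + \<bar>f x - h y\<bar>" and eq: "x = y \<or> f x = h y"
  shows "path_cost p N (graph_path N f x) (graph_path N h y) = (if p = 0 then min d 1 else d powr p)"
proof -
  let ?D = "\<lambda>i::nat. if i = 0 then x - y else if i = 1 then f x - h y else 0"
  have D: "graph_path N f x i - graph_path N h y i = ?D i" if "i \<in> {..<N}" for i
    using that by (simp add: graph_path_def)
  have "L2_set (\<lambda>i. graph_path N f x i - graph_path N h y i) {..<N} = L2_set ?D {..<N}"
    by (rule L2_set_cong[OF refl D])
  also have "\<dots> = sqrt ((x - y)\<^sup>2 + (f x - h y)\<^sup>2)"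
    unfolding L2_set_def by (subst sum_first_two[OF N]) auto
  also have "\<dots> = d" using eq d by auto
  finally have L2: "L2_set (\<lambda>i. graph_path N f x i - graph_path N h y i) {..<N} = d" .
  have "(\<Sum>i<N. \<bar>graph_path N f x i - graph_path N h y i\<bar> powr p) = (\<Sum>i<N. \<bar>?D i\<bar> powr p)"
    by (rule sum.cong[OF refl]) (simp only: D)
  also have "\<dots> = \<bar>x - y\<bar> powr p + \<bar>f x - h y\<bar> powr p"
    by (subst sum_first_two[OF N]) auto
  also have "\<dots> = d powr p" using eq d by auto
  finally show ?thesis by (simp add: path_cost_def L2)
qed

text \<open>Almost surely both nontrivial coordinates have absolute value at most 1, so the sum of
  the powers is at most 2.\<close>

lemma graph_law_in_prob_measures:
  assumes f: "f \<in> borel_measurable borel" and bdd: "\<And>x. \<bar>f x\<bar> \<le> 1" and p: "p = 0 \<or> 1 \<le> p" and N: "2 \<le> N"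
  shows "graph_law N f \<in> prob_measures p N"
proof -
  interpret U: prob_space unit_law by (rule prob_space_unit_law)
  have m: "(\<lambda>x. \<Sum>i<N. \<bar>x i\<bar> powr p) \<in> path_space N \<rightarrow>\<^sub>M borel"
    unfolding path_space_def by measurable
  have gp: "(\<Sum>i<N. \<bar>graph_path N f x i\<bar> powr p) = \<bar>x\<bar> powr p + \<bar>f x\<bar> powr p" for x
  proof -
    have "(\<Sum>i<N. \<bar>graph_path N f x i\<bar> powr p)
        = (\<Sum>i<N. if i = 0 then \<bar>x\<bar> powr p else if i = 1 then \<bar>f x\<bar> powr p else 0)"
      by (rule sum.cong) (auto simp: graph_path_def)
    also have "\<dots> = \<bar>x\<bar> powr p + \<bar>f x\<bar> powr p" by (subst sum_first_two[OF N]) auto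
    finally show ?thesis .
  qed
  have "integrable (graph_law N f) (\<lambda>x. \<Sum>i<N. \<bar>x i\<bar> powr p)" if "p \<noteq> 0"
    unfolding graph_law_def
  proof (subst integrable_distr_eq[OF graph_path_measurable_unit_law[OF f] m], rule U.integrable_const_bound[where B=2])
    have 1: "a powr p \<le> 1" if "0 \<le> a" "a \<le> 1" for a :: real
      using powr_mono2[of p a 1] that p \<open>p \<noteq> 0\<close> by auto
    show "AE x in unit_law. norm (\<Sum>i<N. \<bar>graph_path N f x i\<bar> powr p) \<le> 2"
      using AE_unit_law
    proof eventually_elim
      case (elim x)
      then show ?case using 1[of "\<bar>x\<bar>"] 1[of "\<bar>f x\<bar>"] bdd[of x] unfolding gp by simp
    qed
    show "(\<lambda>x. \<Sum>i<N. \<bar>graph_path N f x i\<bar> powr p) \<in> borel_measurable unit_law"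
      by (rule measurable_compose[OF graph_path_measurable_unit_law[OF f] m])
  qed
  then show ?thesis
    using prob_space_graph_law[OF f] by (simp add: prob_measures_def space_prob_algebra)
qed

text \<open>Coupling by the digit swap makes the second coordinates equal, so only the displacement
  \<open>swap_step\<close> of the first one is paid. It is uniformly at most
  \<open>(1 / 2) ^ M\<close>, and \<open>cost_root\<close> undoes the power in the cost.\<close>

lemma AW_digit_le:
  assumes p: "p = 0 \<or> 1 \<le> p" and N: "2 \<le> N" and M: "M \<le> m" "M \<le> n"
  shows "AW p N (graph_law N (digit m)) (graph_law N (digit n)) \<le> (1 / 2) ^ M"
proof -
  interpret U: prob_space unit_law by (rule prob_space_unit_law)
  let ?d = "\<lambda>x. \<bar>swap_step m n x\<bar>" and ?\<delta> = "(1 / 2 :: real) ^ M"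
  let ?c = "\<lambda>d. if p = 0 then min d 1 else d powr p :: real"
  have c: "path_cost p N (graph_path N (digit m) x) (graph_path N (digit n) (x + swap_step m n x)) = ?c (?d x)" for x
    by (rule path_cost_graph[OF N]) (auto simp: swap_digits)
  have le: "?c (?d x) \<le> ?c ?\<delta>" for x
    using abs_swap_step_le[OF M, of x] p by (auto intro!: powr_mono2)
  have nonneg: "0 \<le> ?c (?d x)" for x by simp
  have mc: "(\<lambda>x. ?c (?d x)) \<in> borel_measurable unit_law" by measurable
  have "integrable unit_law (\<lambda>x. ?c (?d x))"
    using le nonneg mc by (intro U.integrable_const_bound[where B="?c ?\<delta>"] AE_I2) (simp_all only: real_norm_def abs_of_nonneg)
  then have int: "(\<integral>x. ?c (?d x) \<partial>unit_law) \<le> ?c ?\<delta>"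
    by (rule U.integral_le_const) (intro AE_I2 le)
  have int0: "0 \<le> (\<integral>x. ?c (?d x) \<partial>unit_law)"
    by (intro integral_nonneg_AE AE_I2 nonneg)
  have "AW p N (graph_law N (digit m)) (graph_law N (digit n)) \<le> cost_root p (\<integral>x. ?c (?d x) \<partial>unit_law)"
    using AW_le_coupling[OF digit_measurable[of m] digit_measurable[of n] _ distr_unit_law_swap[of m n] N, of p] by (simp only: c) simp
  also have "\<dots> \<le> ?\<delta>"
  proof (cases "p = 0")
    case True
    then show ?thesis using int by (simp add: cost_root_def)
  next
    case False
    then have "(\<integral>x. ?c (?d x) \<partial>unit_law) powr (1 / p) \<le> (?\<delta> powr p) powr (1 / p)"
      using int int0 p by (intro powr_mono2) auto
    then show ?thesis using False by (simp add: cost_root_def powr_powr)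
  qed
  finally show ?thesis .
qed

section \<open>The quantile process of a graph\<close>

lemma space_cube_measure: "space (cube_measure N) = {..<N} \<rightarrow>\<^sub>E {0<..<1}"
  by (simp add: cube_measure_def space_PiM space_restrict_space)

lemma prob_space_cube_measure: "prob_space (cube_measure N)"
  unfolding cube_measure_def by (intro prob_space_PiM prob_space_unit_interval)

lemma measurable_cube_coordinate:
  assumes "i < N"
  shows "(\<lambda>u. u i) \<in> cube_measure N \<rightarrow>\<^sub>M borel"
proof -
  have "(\<lambda>u. u i) \<in> cube_measure N \<rightarrow>\<^sub>M restrict_space lborel {0<..<1::real}"
    using assms by (simp add: cube_measure_def)
  moreover have "(\<lambda>x. x) \<in> restrict_space lborel {0<..<1::real} \<rightarrow>\<^sub>M borel"
    by (auto intro: measurable_restrict_space1)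
  ultimately show ?thesis by (rule measurable_compose)
qed

lemma measurable_graph_path_cube:
  assumes "f \<in> borel_measurable borel" "0 < N"
  shows "(\<lambda>u. graph_path N f (u 0)) \<in> cube_measure N \<rightarrow>\<^sub>M path_space N"
  by (rule measurable_compose[OF measurable_cube_coordinate[OF assms(2)] graph_path_measurable[OF assms(1)]])

lemma distr_cube_graph_path:
  assumes f: "f \<in> borel_measurable borel" and N: "0 < N"
  shows "distr (cube_measure N) (path_space N) (\<lambda>u. graph_path N f (u 0)) = graph_law N f"
  unfolding graph_law_def distr_cube_coordinate[OF N, symmetric]
  by (subst distr_distr[OF graph_path_measurable[OF f] measurable_cube_coordinate[OF N]]) (simp add: comp_def)

text \<open>Coordinate 0 is the identity, so equality there in (con) forces equal arguments. The
  other coordinates depend on \<open>u 0\<close> alone, so changing a later variable alters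
  nothing.\<close>

lemma quantile_process_graph_path:
  assumes f: "f \<in> borel_measurable borel" and N: "0 < N"
  shows "quantile_process N (\<lambda>u. graph_path N f (u 0))"
  unfolding quantile_process_def triangular_def
proof (intro conjI ballI allI impI)
  show "(\<lambda>u. graph_path N f (u 0)) \<in> cube_measure N \<rightarrow>\<^sub>M path_space N"
    by (rule measurable_graph_path_cube[OF f N])
qed (auto simp: graph_path_def split: if_splits)

text \<open>A monotone map of the unit interval with uniform law is the identity: comparing
  distribution functions rules out a value above or below the argument. The conclusion holds at
  every point of the cube.\<close>

lemma quantile_process_first_coordinate:
  assumes Q: "quantile_process N Q" and N: "0 < N"
    and law: "distr (cube_measure N) borel (\<lambda>u. Q u 0) = unit_law"
    and u: "u \<in> space (cube_measure N)"
  shows "Q u 0 = u 0"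
proof -
  interpret C: prob_space "cube_measure N" by (rule prob_space_cube_measure)
  let ?S = "space (cube_measure N)"
  have Qm: "(\<lambda>w. Q w 0) \<in> cube_measure N \<rightarrow>\<^sub>M borel"
    using Q measurable_compose[OF _ measurable_path_component[OF N]] by (auto simp: quantile_process_def)
  have um: "(\<lambda>w. w 0) \<in> cube_measure N \<rightarrow>\<^sub>M (borel :: real measure)"
    by (rule measurable_cube_coordinate[OF N])
  have prob: "C.prob {w \<in> ?S. X w \<le> t} = t" "{w \<in> ?S. X w \<le> t} \<in> C.events"
    if X: "X \<in> cube_measure N \<rightarrow>\<^sub>M borel" and "distr (cube_measure N) borel X = unit_law"
      and t: "0 \<le> t" "t < 1" for X t
  proof -
    have "{w \<in> ?S. X w \<le> t} = X -` {..t} \<inter> ?S" by auto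
    then show "C.prob {w \<in> ?S. X w \<le> t} = t" "{w \<in> ?S. X w \<le> t} \<in> C.events"
      using measure_distr[OF X, of "{..t}"] measurable_sets[OF X, of "{..t}"] measure_unit_law_atMost[OF t] that(2)
      by auto
  qed
  note prob_Q = prob[OF Qm law] and prob_u = prob[OF um distr_cube_coordinate[OF N]]
  have in01: "0 < w 0 \<and> w 0 < 1" if "w \<in> ?S" for w
    using that N by (auto simp: space_cube_measure PiE_iff)
  note inc = Q[unfolded quantile_process_def, THEN conjunct2, THEN conjunct2]
  \<comment> \<open>(inc) varies one variable only; triangularity then allows replacing the
    remaining variables of \<open>w\<close> by those of \<open>v\<close>.\<close>
  have mono: "Q w 0 \<le> Q v 0" if w: "w \<in> ?S" and v: "v \<in> ?S" and "w 0 \<le> v 0" for w v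
  proof -
    have "w(0 := v 0) \<in> ?S"
      using w v N by (auto simp: space_cube_measure PiE_iff extensional_def)
    moreover have "triangular N Q" using Q by (simp only: quantile_process_def)
    ultimately have "Q (w(0 := v 0)) 0 = Q v 0"
      using v N unfolding triangular_def by (metis fun_upd_same le_zero_eq)
    moreover have "Q w 0 \<le> Q (w(0 := v 0)) 0"
      using inc[THEN bspec, OF w, THEN spec, THEN mp, OF N, THEN bspec, of "v 0"] in01[OF v] \<open>w 0 \<le> v 0\<close>
      by simp
    ultimately show ?thesis by simp
  qed
  note u01 = in01[OF u]
  show ?thesis
  proof (rule antisym)
    show "Q u 0 \<le> u 0"
    proof (rule ccontr)
      assume "\<not> Q u 0 \<le> u 0"
      \<comment> \<open>Taking the minimum with 1 keeps \<open>t\<close> in the range where the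
        distribution function is the identity. The event \<open>Q w 0 \<le> t\<close> has
        probability \<open>t\<close>, yet forces \<open>w 0 \<le> u 0\<close>, which has smaller
        probability.\<close>
      then obtain t where t: "u 0 < t" "t < Q u 0" "t < 1"
        using dense[of "u 0" "min (Q u 0) 1"] u01 by auto
      have "w 0 \<le> u 0" if "w \<in> ?S" "Q w 0 \<le> t" for w
        using mono[OF u that(1)] that(2) t by linarith
      then have "C.prob {w \<in> ?S. Q w 0 \<le> t} \<le> C.prob {w \<in> ?S. w 0 \<le> u 0}"
        using prob_u(2)[of "u 0"] u01 by (intro C.finite_measure_mono) auto
      then show False using prob_Q(1)[of t] prob_u(1)[of "u 0"] t u01 by simp
    qed
    show "u 0 \<le> Q u 0"
    proof (rule ccontr)
      assume *: "\<not> u 0 \<le> Q u 0"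
      \<comment> \<open>A priori \<open>Q u 0\<close> may be negative, hence the truncation at
        0.\<close>
      define t where "t = max (Q u 0) 0"
      have t: "0 \<le> t" "t < u 0" "Q u 0 \<le> t" using * u01 by (auto simp: t_def)
      have "Q w 0 \<le> t" if "w \<in> ?S" "w 0 \<le> u 0" for w
        using mono[OF that(1) u that(2)] t by linarith
      then have "C.prob {w \<in> ?S. w 0 \<le> u 0} \<le> C.prob {w \<in> ?S. Q w 0 \<le> t}"
        using prob_Q(2)[of t] t u01 by (intro C.finite_measure_mono) auto
      then show False using prob_Q(1)[of t] prob_u(1)[of "u 0"] t u01 by simp
    qed
  qed
qed

text \<open>The first coordinate is already determined pointwise. The law then determines the others
  almost surely, being carried by the graph, and extensionality settles the indices from
  \<open>N\<close> on.\<close>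

lemma quantile_process_graph_law_unique:
  assumes f: "f \<in> borel_measurable borel" and N: "0 < N"
    and Q: "quantile_process N Q" and law: "distr (cube_measure N) (path_space N) Q = graph_law N f"
  shows "AE u in cube_measure N. Q u = graph_path N f (u 0)"
proof -
  have Qm: "Q \<in> cube_measure N \<rightarrow>\<^sub>M path_space N" using Q by (simp add: quantile_process_def)
  have "distr (cube_measure N) borel (\<lambda>u. Q u 0) = distr (graph_law N f) borel (\<lambda>x. x 0)"
    unfolding law[symmetric] by (subst distr_distr[OF measurable_path_component[OF N] Qm]) (simp add: comp_def)
  then have Q0: "Q u 0 = u 0" if "u \<in> space (cube_measure N)" for u
    using quantile_process_first_coordinate[OF Q N _ that] distr_graph_law_first[OF f N] by simp
  have "AE x in graph_law N f. \<forall>k\<in>{0<..<N}. x k = (if k = 1 then f (x 0) else 0)"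
    using AE_graph_law[OF f] by (intro AE_finite_allI) auto
  then have "AE u in cube_measure N. \<forall>k\<in>{0<..<N}. Q u k = (if k = 1 then f (Q u 0) else 0)"
    unfolding law[symmetric] by (rule AE_distrD[OF Qm])
  then show ?thesis
  proof (rule AE_mp, intro AE_I2 impI ext)
    fix u k assume u: "u \<in> space (cube_measure N)"
      and *: "\<forall>k\<in>{0<..<N}. Q u k = (if k = 1 then f (Q u 0) else 0)"
    have "Q u \<in> extensional {..<N}"
      using measurable_space[OF Qm u] by (simp add: path_space_def space_PiM PiE_iff)
    then show "Q u k = graph_path N f (u 0) k"
      using * Q0[OF u] by (auto simp: graph_path_def extensional_def)
  qed
qed

text \<open>The explicit process shows that the choice in \<open>quantile_of\<close> is from a
  nonempty set; uniqueness identifies the chosen version almost surely.\<close>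

lemma quantile_of_graph_law:
  assumes f: "f \<in> borel_measurable borel" and N: "0 < N"
  shows "quantile_of N (graph_law N f) \<in> cube_measure N \<rightarrow>\<^sub>M path_space N"
    and "AE u in cube_measure N. quantile_of N (graph_law N f) u = graph_path N f (u 0)"
proof -
  have Q: "quantile_process N (quantile_of N (graph_law N f)) \<and>
      distr (cube_measure N) (path_space N) (quantile_of N (graph_law N f)) = graph_law N f"
    unfolding quantile_of_def
    by (rule someI[where x="\<lambda>u. graph_path N f (u 0)"])
      (intro conjI quantile_process_graph_path distr_cube_graph_path f N)
  then show "quantile_of N (graph_law N f) \<in> cube_measure N \<rightarrow>\<^sub>M path_space N"
    by (simp add: quantile_process_def)
  show "AE u in cube_measure N. quantile_of N (graph_law N f) u = graph_path N f (u 0)"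
    using Q by (intro quantile_process_graph_law_unique f N) auto
qed

section \<open>Knothe-Rosenblatt distances of graph laws\<close>

lemma path_cost_measurable_compose:
  assumes "F \<in> M \<rightarrow>\<^sub>M path_space N" "H \<in> M \<rightarrow>\<^sub>M path_space N"
  shows "(\<lambda>w. path_cost p N (F w) (H w)) \<in> borel_measurable M"
  using measurable_compose[OF measurable_Pair[OF assms] path_cost_measurable] by simp

lemma KR_graph_law:
  assumes f: "f \<in> borel_measurable borel" and h: "h \<in> borel_measurable borel" and N: "0 < N"
  shows "KR p N (graph_law N f) (graph_law N h)
    = cost_root p (\<integral>x. path_cost p N (graph_path N f x) (graph_path N h x) \<partial>unit_law)"
proof -
  have "(\<integral>u. path_cost p N (quantile_of N (graph_law N f) u) (quantile_of N (graph_law N h) u) \<partial>cube_measure N)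
    = (\<integral>u. path_cost p N (graph_path N f (u 0)) (graph_path N h (u 0)) \<partial>cube_measure N)"
    using quantile_of_graph_law(2)[OF f N] quantile_of_graph_law(2)[OF h N]
    by (intro integral_cong_AE path_cost_measurable_compose quantile_of_graph_law(1) measurable_graph_path_cube f h N) auto
  also have "\<dots> = (\<integral>x. path_cost p N (graph_path N f x) (graph_path N h x) \<partial>unit_law)"
    unfolding distr_cube_coordinate[OF N, symmetric]
    by (rule integral_distr[symmetric])
      (intro measurable_cube_coordinate path_cost_measurable_compose graph_path_measurable f h N)+
  finally show ?thesis by (simp add: KR_def)
qed

text \<open>Different digits differ by exactly 1, so for every \<open>p\<close> the cost is the
  indicator of the event that they differ, which has probability 1/2.\<close>

lemma KR_digit:
  assumes N: "2 \<le> N" and mn: "m \<noteq> n"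
  shows "KR p N (graph_law N (digit m)) (graph_law N (digit n)) = cost_root p (1 / 2)"
proof -
  have "path_cost p N (graph_path N (digit m) x) (graph_path N (digit n) x)
      = indicator {x. digit m x \<noteq> digit n x} x" for x
    using digit_cases[of m x] digit_cases[of n x]
    by (subst path_cost_graph[OF N refl]) auto
  then show ?thesis
    using N by (simp add: KR_graph_law measure_digits_differ[OF mn])
qed

section \<open>Cauchy property and uniform separation of the sequence of digit laws\<close>

theorem proposition4p7:
  fixes p :: real and N :: nat
  assumes "p = 0 \<or> 1 \<le> p" and "2 \<le> N"
  shows "\<exists>\<mu> :: nat \<Rightarrow> (nat \<Rightarrow> real) measure.
           (\<forall>n. \<mu> n \<in> prob_measures p N) \<and>
           Cauchy_wrt (AW p N) \<mu> \<and>
           (\<nexists>r. strict_mono r \<and> Cauchy_wrt (KR p N) (\<mu> \<circ> r)) \<and>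
           Inf {KR p N (\<mu> k) (\<mu> n) | k n. k \<noteq> n} > 0"
proof (intro exI[of _ "\<lambda>n. graph_law N (digit n)"] conjI allI)
  let ?\<mu> = "\<lambda>n. graph_law N (digit n)" and ?c = "cost_root p (1 / 2)"
  have c: "0 < ?c" by (simp add: cost_root_def)
  note KR = KR_digit[OF assms(2)]
  show "graph_law N (digit n) \<in> prob_measures p N" for n
    using digit_cases[of n] by (intro graph_law_in_prob_measures assms digit_measurable) (metis abs_0 abs_1 order_refl zero_le_one)
  show "Cauchy_wrt (AW p N) ?\<mu>"
    unfolding Cauchy_wrt_def
  proof (intro allI impI)
    fix \<epsilon> :: real assume "0 < \<epsilon>"
    then obtain M where M: "(1 / 2) ^ M < \<epsilon>"
      using real_arch_pow_inv[of \<epsilon> "1 / 2"] by auto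
    have "AW p N (?\<mu> m) (?\<mu> n) < \<epsilon>" if "M \<le> m" "M \<le> n" for m n
      using AW_digit_le[OF assms that] M by simp
    then show "\<exists>M. \<forall>m\<ge>M. \<forall>n\<ge>M. AW p N (?\<mu> m) (?\<mu> n) < \<epsilon>" by blast
  qed
  show "\<nexists>r. strict_mono r \<and> Cauchy_wrt (KR p N) (?\<mu> \<circ> r)"
  proof safe
    fix r :: "nat \<Rightarrow> nat" assume r: "strict_mono r" and "Cauchy_wrt (KR p N) (?\<mu> \<circ> r)"
    \<comment> \<open>The tolerance is the common distance \<open>?c\<close> itself, which no two
      distinct members can undercut.\<close>
    then obtain M where "\<forall>m\<ge>M. \<forall>n\<ge>M. KR p N (?\<mu> (r m)) (?\<mu> (r n)) < ?c"
      using c unfolding Cauchy_wrt_def by auto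
    then have "KR p N (?\<mu> (r M)) (?\<mu> (r (Suc M))) < ?c" by simp
    moreover have "r M \<noteq> r (Suc M)" using strict_mono_less[OF r, of M "Suc M"] by simp
    ultimately show False using KR by simp
  qed
  \<comment> \<open>All distances between distinct members coincide, so the infimum is that of a
    singleton; the indices 0 and 1 show that the set is nonempty.\<close>
  have "{KR p N (?\<mu> k) (?\<mu> n) | k n. k \<noteq> n} = {?c}"
  proof -
    have "\<exists>k n. ?c = KR p N (?\<mu> k) (?\<mu> n) \<and> k \<noteq> n"
      using KR[of 0 1] by (intro exI[of _ 0] exI[of _ 1]) simp
    then show ?thesis using KR by auto
  qed
  then show "0 < Inf {KR p N (?\<mu> k) (?\<mu> n) | k n. k \<noteq> n}" using c by simp
qed

end
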